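(* Let $p>1$ be a real number and let $\Gamma$ be a connected graph of bounded degree, without self-loops, with countably infinite vertex set $V$. Let $P$ be the set of all one-sided infinite paths without self-intersections in $\Gamma$. For $f\in B(\overline{C_c(\Gamma)}_{D_p})$ let $A_f$ be the set of paths $\gamma=(x_0,x_1,x_2,\dots)\in P$ for which $f(\gamma)=\lim_{n\to\infty}f(x_n)=0$ fails (so $P\setminus A_f$ consists of the paths along which $f$ tends to $0$), and let $$E_f=\overline{\bigcup_{\gamma\in P\setminus A_f}E(\gamma)},$$ where $E(\gamma)$ is the set of extreme points of $\gamma$ and the closure is taken in $Sp(BD_p(\Gamma))$. Then $$\partial_p(\Gamma)=\bigcap_{f\in B(\overline{C_c(\Gamma)}_{D_p})}E_f ,$$ where $\partial_p(\Gamma)$ is the $p$-harmonic boundary of $\Gamma$.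
   Context: Graphs are undirected; $N_x$ denotes the set of neighbors of a vertex $x$. Bounded degree means there is an integer $k$ with $|N_x|\le k$ for all $x\in V$. A one-sided infinite path without self-intersections is a sequence $x_0,x_1,x_2,\dots$ of pairwise distinct vertices with $x_{n+1}\in N_{x_n}$ for all $n$. For $f:V\to\mathbb{R}$ set $I_p(f,V)=\sum_{x\in V}\sum_{y\in N_x}|f(y)-f(x)|^p$. Let $D_p(\Gamma)=\{f:V\to\mathbb{R}\mid I_p(f,V)<\infty\}$ with norm $\|f\|_{D_p}=(I_p(f,V)+|f(o)|^p)^{1/p}$, where $o\in V$ is a fixed vertex. Let $BD_p(\Gamma)$ be the set of bounded functions in $D_p(\Gamma)$; with norm $\|f\|_{BD_p}=I_p(f,V)^{1/p}+\sup_V|f|$ and pointwise operations it is a commutative Banach algebra. Let $C_c(\Gamma)$ be the set of finitely supported functions on $V$, $\overline{C_c(\Gamma)}_{D_p}$ its closure in $D_p(\Gamma)$, and $B(\overline{C_c(\Gamma)}_{D_p})$ the set of bounded functions in $\overline{C_c(\Gamma)}_{D_p}$. $Sp(BD_p(\Gamma))$ is the set of characters of $BD_p(\Gamma)$, i.e. nonzero $\mathbb{R}$-linear ring homomorphisms $\chi:BD_p(\Gamma)\to\mathbb{C}$, with the weak-$*$ topology (the topology of pointwise convergence on $BD_p(\Gamma)$); it is compact Hausdorff. The map $i:V\to Sp(BD_p(\Gamma))$, $i(x)(f)=f(x)$, is injective with open dense image. The $p$-Royden boundary is the compact set $R_p(\Gamma)=Sp(BD_p(\Gamma))\setminus i(V)$.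 The $p$-harmonic boundary is $\partial_p(\Gamma)=\{\chi\in R_p(\Gamma)\mid \chi(f)=0\text{ for all } f\in B(\overline{C_c(\Gamma)}_{D_p})\}$. For $\gamma\in P$ with vertex set $V(\gamma)$, let $\overline{V}(\gamma)$ be the closure of $i(V(\gamma))$ in $Sp(BD_p(\Gamma))$. The set of extreme points of $\gamma$ is $E(\gamma)=\overline{V}(\gamma)\cap R_p(\Gamma)$. *)

theory Defs
  imports "HOL-Analysis.Analysis"
begin

text \<open>
  A graph is given by its adjacency relation on a type of vertices, so \<^term>\<open>UNIV\<close> is the
  vertex set \<open>V\<close>.
\<close>

definition nbrs :: "('v \<Rightarrow> 'v \<Rightarrow> bool) \<Rightarrow> 'v \<Rightarrow> 'v set" where
  "nbrs adj x = {y. adj x y}"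

definition bounded_degree :: "('v \<Rightarrow> 'v \<Rightarrow> bool) \<Rightarrow> bool" where
  "bounded_degree adj \<longleftrightarrow> (\<exists>k::nat. \<forall>x. finite (nbrs adj x) \<and> card (nbrs adj x) \<le> k)"

definition connected_graph :: "('v \<Rightarrow> 'v \<Rightarrow> bool) \<Rightarrow> bool" where
  "connected_graph adj \<longleftrightarrow> (\<forall>x y. adj\<^sup>*\<^sup>* x y)"

definition inf_paths :: "('v \<Rightarrow> 'v \<Rightarrow> bool) \<Rightarrow> (nat \<Rightarrow> 'v) set" where
  "inf_paths adj = {\<gamma>. inj \<gamma> \<and> (\<forall>n. \<gamma> (Suc n) \<in> nbrs adj (\<gamma> n))}"

definition local_energy :: "('v \<Rightarrow> 'v \<Rightarrow> bool) \<Rightarrow> real \<Rightarrow> ('v \<Rightarrow> real) \<Rightarrow> 'v \<Rightarrow> real" where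
  "local_energy adj p f x = (\<Sum>y\<in>nbrs adj x. \<bar>f y - f x\<bar> powr p)"

text \<open>
  \<open>I\<^sub>p(f, V)\<close> is real-valued here. As \<^const>\<open>infsum\<close> is \<open>0\<close> on non-summable families, its
  finiteness is expressed by summability of the nonnegative family of local energies.
\<close>

definition Ip :: "('v \<Rightarrow> 'v \<Rightarrow> bool) \<Rightarrow> real \<Rightarrow> ('v \<Rightarrow> real) \<Rightarrow> real" where
  "Ip adj p f = (\<Sum>\<^sub>\<infinity>x\<in>UNIV. local_energy adj p f x)"

definition Dp :: "('v \<Rightarrow> 'v \<Rightarrow> bool) \<Rightarrow> real \<Rightarrow> ('v \<Rightarrow> real) set" where
  "Dp adj p = {f. local_energy adj p f summable_on UNIV}"

text \<open>The base vertex written \<open>o\<close> in the mathematics is called \<open>b\<close>.\<close>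

definition Dp_norm :: "('v \<Rightarrow> 'v \<Rightarrow> bool) \<Rightarrow> real \<Rightarrow> 'v \<Rightarrow> ('v \<Rightarrow> real) \<Rightarrow> real" where
  "Dp_norm adj p b f = (Ip adj p f + \<bar>f b\<bar> powr p) powr (1 / p)"

definition BDp :: "('v \<Rightarrow> 'v \<Rightarrow> bool) \<Rightarrow> real \<Rightarrow> ('v \<Rightarrow> real) set" where
  "BDp adj p = {f \<in> Dp adj p. bounded (range f)}"

definition Cc :: "('v \<Rightarrow> real) set" where
  "Cc = {f. finite {x. f x \<noteq> 0}}"

definition Cc_closure :: "('v \<Rightarrow> 'v \<Rightarrow> bool) \<Rightarrow> real \<Rightarrow> 'v \<Rightarrow> ('v \<Rightarrow> real) set" where
  "Cc_closure adj p b =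
     {f \<in> Dp adj p. \<forall>\<epsilon>>0. \<exists>g\<in>Cc. Dp_norm adj p b (\<lambda>x. f x - g x) < \<epsilon>}"

definition BCc_closure :: "('v \<Rightarrow> 'v \<Rightarrow> bool) \<Rightarrow> real \<Rightarrow> 'v \<Rightarrow> ('v \<Rightarrow> real) set" where
  "BCc_closure adj p b = {f \<in> Cc_closure adj p b. bounded (range f)}"

text \<open>
  Characters are functions on \<^const>\<open>BDp\<close>; they are made \<^const>\<open>extensional\<close> (with the value
  \<^const>\<open>undefined\<close> outside \<^const>\<open>BDp\<close>), so that equality of characters is equality on
  \<^const>\<open>BDp\<close> and \<open>Sp\<close> is a subset of the carrier of the product topology.
\<close>

definition Sp :: "('v \<Rightarrow> 'v \<Rightarrow> bool) \<Rightarrow> real \<Rightarrow> (('v \<Rightarrow> real) \<Rightarrow> complex) set" where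
  "Sp adj p = {\<phi> \<in> extensional (BDp adj p).
     (\<forall>f\<in>BDp adj p. \<forall>g\<in>BDp adj p. \<phi> (\<lambda>x. f x + g x) = \<phi> f + \<phi> g) \<and>
     (\<forall>c::real. \<forall>f\<in>BDp adj p. \<phi> (\<lambda>x. c * f x) = of_real c * \<phi> f) \<and>
     (\<forall>f\<in>BDp adj p. \<forall>g\<in>BDp adj p. \<phi> (\<lambda>x. f x * g x) = \<phi> f * \<phi> g) \<and>
     (\<exists>f\<in>BDp adj p. \<phi> f \<noteq> 0)}"

definition Sp_top :: "('v \<Rightarrow> 'v \<Rightarrow> bool) \<Rightarrow> real \<Rightarrow> (('v \<Rightarrow> real) \<Rightarrow> complex) topology" where
  "Sp_top adj p = subtopology (product_topology (\<lambda>_. euclidean) (BDp adj p)) (Sp adj p)"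

definition eval_char :: "('v \<Rightarrow> 'v \<Rightarrow> bool) \<Rightarrow> real \<Rightarrow> 'v \<Rightarrow> ('v \<Rightarrow> real) \<Rightarrow> complex" where
  "eval_char adj p x = (\<lambda>f\<in>BDp adj p. of_real (f x))"

definition Royden_boundary :: "('v \<Rightarrow> 'v \<Rightarrow> bool) \<Rightarrow> real \<Rightarrow> (('v \<Rightarrow> real) \<Rightarrow> complex) set" where
  "Royden_boundary adj p = Sp adj p - range (eval_char adj p)"

definition harmonic_boundary ::
  "('v \<Rightarrow> 'v \<Rightarrow> bool) \<Rightarrow> real \<Rightarrow> 'v \<Rightarrow> (('v \<Rightarrow> real) \<Rightarrow> complex) set" where
  "harmonic_boundary adj p b =
     {\<phi> \<in> Royden_boundary adj p. \<forall>f\<in>BCc_closure adj p b. \<phi> f = 0}"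

definition extreme_pts ::
  "('v \<Rightarrow> 'v \<Rightarrow> bool) \<Rightarrow> real \<Rightarrow> (nat \<Rightarrow> 'v) \<Rightarrow> (('v \<Rightarrow> real) \<Rightarrow> complex) set" where
  "extreme_pts adj p \<gamma> =
     (Sp_top adj p closure_of (eval_char adj p ` range \<gamma>)) \<inter> Royden_boundary adj p"

definition exc_paths :: "('v \<Rightarrow> 'v \<Rightarrow> bool) \<Rightarrow> ('v \<Rightarrow> real) \<Rightarrow> (nat \<Rightarrow> 'v) set" where
  "exc_paths adj f = {\<gamma> \<in> inf_paths adj. \<not> (\<lambda>n. f (\<gamma> n)) \<longlonglongrightarrow> 0}"

definition E_set ::
  "('v \<Rightarrow> 'v \<Rightarrow> bool) \<Rightarrow> real \<Rightarrow> ('v \<Rightarrow> real) \<Rightarrow> (('v \<Rightarrow> real) \<Rightarrow> complex) set" where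
  "E_set adj p f =
     Sp_top adj p closure_of (\<Union>\<gamma>\<in>inf_paths adj - exc_paths adj f. extreme_pts adj p \<gamma>)"

end

theory Submission
  imports Defs
begin

text \<open>
  A character in \<open>E(\<gamma>)\<close> lies in the closure of every tail of \<open>\<gamma>\<close>, so it kills each \<open>f\<close> that tends
  to \<open>0\<close> along \<open>\<gamma>\<close>; as \<open>R\<^sub>p\<close> and the zero set of \<open>f\<close> are closed, this gives the inclusion
  \<open>\<supseteq>\<close>.

  For \<open>\<subseteq>\<close>, suppose that \<open>\<psi> \<in> \<partial>\<^sub>p\<close> has a neighbourhood missing \<open>E\<^sub>f\<close>, given by
  \<open>\<bar>\<phi>(j) - \<psi>(j)\<bar> < \<epsilon>\<close> for finitely many \<open>j\<close>. Put \<open>q = \<Sum>\<^sub>j \<bar>j - \<psi>(j)\<bar>\<^sup>2\<close>, so that \<open>\<psi>(q) = 0\<close>,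
  and \<open>G = 1 - q / max(q, \<delta>)\<close>, so that \<open>\<psi>(G) = 1\<close> while \<open>G\<close> vanishes off \<open>S = {q < \<delta>}\<close>. A path
  inside \<open>S\<close> has an extreme point, by compactness, and it lies in the neighbourhood; hence \<open>f\<close> does
  not tend to \<open>0\<close> along any path in \<open>S\<close>. Approximating \<open>f\<close> by finitely supported functions gives a
  weight \<open>W \<in> \<ell>\<^sup>p\<close> for which all these paths have infinite length (they form a family of infinite
  extremal length), and by Koenig's lemma balls of the resulting path metric \<open>d\<close> on \<open>S\<close> are finite.
  The functions \<open>G \<cdot> max(0, 1 - d/n)\<close> are thus finitely supported, and they converge to \<open>G\<close> in \<open>D\<^sub>p\<close>.
  So \<open>\<psi>(G) = 0\<close>, a contradiction.
\<close>

section \<open>Energies and dominated convergence\<close>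

text \<open>Comparing \<open>a + b\<close> with twice the maximum gives a crude constant, but it
  works for every exponent \<open>p \<ge> 0\<close> without any appeal to convexity.\<close>

lemma add_powr_le:
  fixes a b p :: real
  assumes "0 \<le> a" "0 \<le> b" "0 \<le> p"
  shows "(a + b) powr p \<le> 2 powr p * (a powr p + b powr p)"
proof -
  have "(a + b) powr p \<le> (2 * max a b) powr p"
    using assms by (intro powr_mono2) auto
  also have "\<dots> = 2 powr p * (max a b) powr p"
    using assms by (simp add: powr_mult)
  also have "(max a b) powr p \<le> a powr p + b powr p"
    by (simp add: max_def)
  finally show ?thesis by simp
qed

lemma local_energy_nonneg: "0 \<le> local_energy adj p f x"
  by (simp add: local_energy_def sum_nonneg)

text \<open>The hypothesis speaks only of increments along edges, so one estimate serves sums,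
  differences, products and reciprocals in \<open>BDp\<close>.\<close>

lemma local_energy_add_le:
  assumes "0 \<le> p" "0 \<le> A" "0 \<le> B"
    and "\<And>y. adj x y \<Longrightarrow> \<bar>h y - h x\<bar> \<le> A * \<bar>f y - f x\<bar> + B * \<bar>g y - g x\<bar>"
  shows "local_energy adj p h x \<le>
    2 powr p * (A powr p * local_energy adj p f x + B powr p * local_energy adj p g x)"
proof -
  have "local_energy adj p h x \<le> (\<Sum>y\<in>nbrs adj x. 2 powr p *
      (A powr p * \<bar>f y - f x\<bar> powr p + B powr p * \<bar>g y - g x\<bar> powr p))"
    unfolding local_energy_def
  proof (rule sum_mono)
    fix y assume "y \<in> nbrs adj x"
    then have "\<bar>h y - h x\<bar> powr p \<le> (A * \<bar>f y - f x\<bar> + B * \<bar>g y - g x\<bar>) powr p"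
      using assms by (intro powr_mono2) (auto simp: nbrs_def)
    also have "\<dots> \<le> 2 powr p * ((A * \<bar>f y - f x\<bar>) powr p + (B * \<bar>g y - g x\<bar>) powr p)"
      using assms by (intro add_powr_le) auto
    finally show "\<bar>h y - h x\<bar> powr p \<le> 2 powr p *
      (A powr p * \<bar>f y - f x\<bar> powr p + B powr p * \<bar>g y - g x\<bar> powr p)"
      using assms by (simp add: powr_mult)
  qed
  then show ?thesis
    by (simp add: local_energy_def sum.distrib sum_distrib_left distrib_left)
qed

lemma Dp_add_le:
  assumes "f \<in> Dp adj p" "g \<in> Dp adj p" "0 \<le> p" "0 \<le> A" "0 \<le> B"
    and "\<And>x y. adj x y \<Longrightarrow> \<bar>h y - h x\<bar> \<le> A * \<bar>f y - f x\<bar> + B * \<bar>g y - g x\<bar>"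
  shows "h \<in> Dp adj p"
proof -
  have "(\<lambda>x. 2 powr p * (A powr p * local_energy adj p f x + B powr p * local_energy adj p g x))
      summable_on UNIV"
    using assms(1,2)
    by (intro summable_on_cmult_right summable_on_add) (auto simp: Dp_def)
  then show ?thesis
    unfolding Dp_def mem_Collect_eq
    by (rule summable_on_comparison_test)
      (use local_energy_add_le[OF assms(3-6)] in \<open>auto simp: local_energy_nonneg\<close>)
qed

text \<open>Dominated convergence for sums: a finite set \<open>F\<close> carries all of
  \<open>D\<close> up to \<open>e / 2\<close>, which bounds the tails of all \<open>E n\<close> at
  once, and on \<open>F\<close> only finitely many pointwise limits are involved.\<close>

lemma infsum_dominated_tendsto_0:
  fixes E :: "nat \<Rightarrow> 'a \<Rightarrow> real"
  assumes D: "D summable_on UNIV"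
    and E: "\<And>n x. 0 \<le> E n x" "\<And>n x. E n x \<le> D x"
    and lim: "\<And>x. (\<lambda>n. E n x) \<longlonglongrightarrow> 0"
  shows "(\<lambda>n. \<Sum>\<^sub>\<infinity>x\<in>UNIV. E n x) \<longlonglongrightarrow> 0"
proof (rule LIMSEQ_I)
  fix e :: real assume e: "0 < e"
  obtain F where F: "finite F" "dist (sum D F) (infsum D UNIV) \<le> e / 2"
    using infsum_finite_approximation[OF D, of "e / 2"] e by auto
  have sE: "E n summable_on X" for n X
    by (rule summable_on_subset_banach[OF summable_on_comparison_test[OF D]]) (use E in auto)
  have sD: "D summable_on X" for X
    by (rule summable_on_subset_banach[OF D]) auto
  have split: "infsum f UNIV = sum f F + infsum f (- F)" if "\<And>X. f summable_on X" for f :: "'a \<Rightarrow> real"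
    using infsum_Un_disjoint[of f F "- F"] that F(1) by simp
  have tail: "infsum (E n) (- F) \<le> e / 2" for n
  proof -
    have "infsum (E n) (- F) \<le> infsum D (- F)"
      by (rule infsum_mono[OF sE sD]) (use E in auto)
    also have "\<dots> \<le> e / 2"
      using F(2) split[OF sD] by (simp add: dist_real_def)
    finally show ?thesis .
  qed
  have "(\<lambda>n. sum (E n) F) \<longlonglongrightarrow> (\<Sum>x\<in>F. 0)"
    by (intro tendsto_sum lim)
  then obtain N where N: "\<And>n. n \<ge> N \<Longrightarrow> norm (sum (E n) F) < e / 2"
    using LIMSEQ_D[of "\<lambda>n. sum (E n) F" 0 "e / 2"] e by auto
  have "norm (infsum (E n) UNIV - 0) < e" if "n \<ge> N" for n
    using N[OF that] tail[of n] split[OF sE, of n] infsum_nonneg[of UNIV "E n"] E(1)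
    by (simp add: abs_if split: if_splits)
  then show "\<exists>N. \<forall>n\<ge>N. norm (infsum (E n) UNIV - 0) < e" by blast
qed

lemma bounded_range_iff: "bounded (range f) \<longleftrightarrow> (\<exists>M. \<forall>x. \<bar>f x :: real\<bar> \<le> M)"
  by (auto simp: bounded_iff)

lemma continuous_map_complex_mult:
  fixes f g :: "'a \<Rightarrow> complex"
  assumes "continuous_map T euclidean f" "continuous_map T euclidean g"
  shows "continuous_map T euclidean (\<lambda>x. f x * g x)"
  using assms by (simp add: continuous_map_atin tendsto_mult)

section \<open>Simple walks and Koenig's lemma\<close>

text \<open>Lists are nodes of a tree in which consing a new head passes to a child. The conditions
  \<open>tl\<close> and \<open>fin\<close> say that \<open>T\<close> is closed under parents and
  finitely branching; an infinite branch is followed by always keeping infinitely many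
  descendants.\<close>

lemma koenig_list:
  fixes T :: "'a list set"
  assumes inf: "infinite T"
    and tl: "\<And>y xs. y # xs \<in> T \<Longrightarrow> xs \<in> T"
    and fin: "\<And>xs. finite {y. y # xs \<in> T}"
  shows "\<exists>\<gamma>. \<forall>n. rev (map \<gamma> [0..<n]) \<in> T"
proof -
  have suffix: "zs @ xs \<in> T \<Longrightarrow> xs \<in> T" for zs xs
    by (induction zs) (auto dest: tl)
  define P where "P n xs \<longleftrightarrow> length xs = n \<and> infinite {zs. zs @ xs \<in> T}" for n xs
  have step: "\<exists>ys. P (Suc n) ys \<and> (\<exists>y. ys = y # xs)" if "P n xs" for n xs
  proof -
    let ?Y = "{y. y # xs \<in> T}"
    have sub: "{zs. zs @ xs \<in> T} \<subseteq> insert [] (\<Union>y\<in>?Y. (\<lambda>zs. zs @ [y]) ` {zs. zs @ (y # xs) \<in> T})"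
    proof
      fix zs assume zs: "zs \<in> {zs. zs @ xs \<in> T}"
      show "zs \<in> insert [] (\<Union>y\<in>?Y. (\<lambda>zs. zs @ [y]) ` {zs. zs @ (y # xs) \<in> T})"
      proof (cases zs rule: rev_cases)
        case (snoc us y)
        then have us: "us @ (y # xs) \<in> T" using zs by simp
        then have "y \<in> ?Y" using suffix by blast
        then show ?thesis using us snoc by blast
      qed simp
    qed
    have "\<exists>y\<in>?Y. infinite {zs. zs @ (y # xs) \<in> T}"
    proof (rule ccontr)
      assume "\<not> ?thesis"
      then have "finite (insert [] (\<Union>y\<in>?Y. (\<lambda>zs. zs @ [y]) ` {zs. zs @ (y # xs) \<in> T}))"
        using fin by simp
      then have "finite {zs. zs @ xs \<in> T}" using sub finite_subset by blast
      then show False using that by (simp add: P_def)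
    qed
    then show ?thesis using that unfolding P_def by (metis length_Cons)
  qed
  have "P 0 []" using inf by (simp add: P_def)
  then obtain F where F: "\<And>n. P n (F n)" "\<And>n. \<exists>y. F (Suc n) = y # F n"
    using dependent_nat_choice[of P "\<lambda>n xs ys. \<exists>y. ys = y # xs"] step by metis
  \<comment> \<open>The list \<open>F (Suc n)\<close> extends \<open>F n\<close> by one head, which
    is therefore the vertex with index \<open>n\<close>.\<close>
  define \<gamma> where "\<gamma> n = hd (F (Suc n))" for n
  have "rev (map \<gamma> [0..<n]) = F n" for n
  proof (induction n)
    case 0
    then show ?case using F(1)[of 0] by (simp add: P_def)
  next
    case (Suc n)
    obtain y where "F (Suc n) = y # F n" using F(2) by blast
    then show ?case using Suc by (simp add: \<gamma>_def)
  qed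
  moreover have "F n \<in> T" for n
  proof -
    have "{zs. zs @ F n \<in> T} \<noteq> {}"
      using F(1)[of n] unfolding P_def by (metis finite.emptyI)
    then show ?thesis using suffix by blast
  qed
  ultimately show ?thesis by metis
qed

text \<open>
  Walks are stored with their last vertex first. The length of a walk includes the index of its
  starting vertex, so that only finitely many starting vertices occur up to a given length.
\<close>

fun walk_in :: "('v \<Rightarrow> 'v \<Rightarrow> bool) \<Rightarrow> 'v set \<Rightarrow> 'v list \<Rightarrow> bool" where
  "walk_in adj S [] \<longleftrightarrow> True"
| "walk_in adj S [x] \<longleftrightarrow> x \<in> S"
| "walk_in adj S (y # x # xs) \<longleftrightarrow> y \<in> S \<and> adj x y \<and> walk_in adj S (x # xs)"

fun walk_length :: "('v \<Rightarrow> nat) \<Rightarrow> ('v \<Rightarrow> real) \<Rightarrow> 'v list \<Rightarrow> real" where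
  "walk_length idx W [] = 0"
| "walk_length idx W [x] = real (idx x)"
| "walk_length idx W (y # x # xs) = min (W x) (W y) + walk_length idx W (x # xs)"

lemma walk_in_tl: "walk_in adj S (y # xs) \<Longrightarrow> walk_in adj S xs"
  by (cases xs) auto

lemma walk_length_tl:
  assumes "\<And>x. 0 \<le> W x"
  shows "walk_length idx W xs \<le> walk_length idx W (y # xs)"
  using assms by (cases xs) auto

lemma walk_in_suffix: "walk_in adj S (as @ xs) \<Longrightarrow> walk_in adj S xs"
  by (induction as) (auto dest: walk_in_tl)

lemma walk_length_suffix:
  assumes "\<And>x. 0 \<le> W x"
  shows "walk_length idx W xs \<le> walk_length idx W (as @ xs)"
  by (induction as) (auto intro: order_trans walk_length_tl[OF assms])

lemma walk_length_nonneg: "(\<And>x. 0 \<le> W x) \<Longrightarrow> 0 \<le> walk_length idx W xs"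
  using walk_length_suffix[of W idx "[]" xs] by simp

text \<open>Loop erasure: if the new vertex \<open>y\<close> already lies on the simple walk, the
  walk is cut back to that visit. In the list this is a suffix, so the starting vertex and its index
  stay the same, and the length does not grow because \<open>W\<close> is nonnegative.\<close>

lemma walk_imp_simple_walk:
  assumes W: "\<And>x. 0 \<le> W x"
  shows "walk_in adj S xs \<Longrightarrow> xs \<noteq> [] \<Longrightarrow> \<exists>ys. walk_in adj S ys \<and> ys \<noteq> [] \<and>
    hd ys = hd xs \<and> distinct ys \<and> walk_length idx W ys \<le> walk_length idx W xs"
proof (induction adj S xs rule: walk_in.induct)
  case (2 adj S x)
  then show ?case by (intro exI[of _ "[x]"]) simp
next
  case (3 adj S y x xs)
  then obtain ys where ys: "walk_in adj S ys" "ys \<noteq> []" "hd ys = x" "distinct ys"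
    "walk_length idx W ys \<le> walk_length idx W (x # xs)"
    by auto
  then obtain zs where zs: "ys = x # zs" by (cases ys) auto
  show ?case
  proof (cases "y \<in> set ys")
    case False
    then show ?thesis using ys zs 3 by (intro exI[of _ "y # ys"]) simp
  next
    case True
    then obtain as bs where ab: "ys = as @ y # bs" by (meson split_list)
    have "walk_length idx W (y # bs) \<le> walk_length idx W ys"
      unfolding ab by (rule walk_length_suffix[OF W])
    also have "\<dots> \<le> walk_length idx W (y # x # xs)"
      using ys(5) W[of x] W[of y] by simp
    finally show ?thesis
      using ys(4) ab walk_in_suffix[of adj S as "y # bs"] ys(1)
      by (intro exI[of _ "y # bs"]) simp
  qed
qed simp

lemma walk_in_rev_path:
  "walk_in adj S (rev (map \<gamma> [0..<Suc n])) \<longleftrightarrow>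
    (\<forall>i\<le>n. \<gamma> i \<in> S) \<and> (\<forall>i<n. adj (\<gamma> i) (\<gamma> (Suc i)))"
proof (induction n)
  case (Suc n)
  then show ?case by (auto simp: le_Suc_eq less_Suc_eq)
qed simp

lemma walk_length_rev_path:
  "walk_length idx W (rev (map \<gamma> [0..<Suc n])) =
    real (idx (\<gamma> 0)) + (\<Sum>i<n. min (W (\<gamma> i)) (W (\<gamma> (Suc i))))"
  by (induction n) auto

section \<open>The algebra \<open>BD\<^sub>p\<close>\<close>

locale royden =
  fixes adj :: "'v \<Rightarrow> 'v \<Rightarrow> bool" and p :: real and b :: 'v
  assumes p_gt_1: "p > 1"
    and sym_adj: "symp adj"
    and connected: "connected_graph adj"
    and bdd_degree: "bounded_degree adj"
    and countable_V: "countable (UNIV :: 'v set)"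
begin

abbreviation "\<B> \<equiv> BDp adj p"

abbreviation "\<iota> \<equiv> eval_char adj p"

abbreviation "X \<equiv> Sp_top adj p"

lemma finite_nbrs: "finite (nbrs adj x)"
  using bdd_degree by (auto simp: bounded_degree_def)

lemma adj_commute: "adj x y \<longleftrightarrow> adj y x"
  using sym_adj by (auto dest: sympD)

lemma BDp_add_le:
  assumes "f \<in> \<B>" "g \<in> \<B>" "0 \<le> A" "0 \<le> B"
    and "\<And>x y. adj x y \<Longrightarrow> \<bar>h y - h x\<bar> \<le> A * \<bar>f y - f x\<bar> + B * \<bar>g y - g x\<bar>"
    and "\<And>x. \<bar>h x\<bar> \<le> M"
  shows "h \<in> \<B>"
proof -
  have "h \<in> Dp adj p"
    by (rule Dp_add_le[of f adj p g A B h]) (use assms p_gt_1 in \<open>auto simp: BDp_def\<close>)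
  then show ?thesis
    using assms(6) by (auto simp: BDp_def bounded_range_iff)
qed

lemma BDp_bounded: "f \<in> \<B> \<Longrightarrow> \<exists>M. \<forall>x. \<bar>f x\<bar> \<le> M"
  by (simp add: BDp_def bounded_range_iff)

lemma Dp_const: "(\<lambda>_. c) \<in> Dp adj p"
proof -
  have "local_energy adj p (\<lambda>_. c) = (\<lambda>_. 0)"
    by (auto simp: local_energy_def)
  then show ?thesis by (simp add: Dp_def)
qed

lemma BDp_const: "(\<lambda>_. c) \<in> \<B>"
  by (simp add: BDp_def Dp_const)

lemma BDp_add:
  assumes "f \<in> \<B>" "g \<in> \<B>"
  shows "(\<lambda>x. f x + g x) \<in> \<B>"
proof -
  obtain M N where M: "\<And>x. \<bar>f x\<bar> \<le> M" and N: "\<And>x. \<bar>g x\<bar> \<le> N"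
    using BDp_bounded assms by metis
  show ?thesis
  proof (rule BDp_add_le[OF assms, of 1 1 _ "M + N"])
    show "\<bar>f x + g x\<bar> \<le> M + N" for x
      using M[of x] N[of x] by linarith
    show "\<bar>f y + g y - (f x + g x)\<bar> \<le> 1 * \<bar>f y - f x\<bar> + 1 * \<bar>g y - g x\<bar>" for x y
      using abs_triangle_ineq[of "f y - f x" "g y - g x"] by (simp add: algebra_simps)
  qed simp_all
qed

lemma BDp_mult:
  assumes "f \<in> \<B>" "g \<in> \<B>"
  shows "(\<lambda>x. f x * g x) \<in> \<B>"
proof -
  obtain M N where M: "\<And>x. \<bar>f x\<bar> \<le> M" and N: "\<And>x. \<bar>g x\<bar> \<le> N"
    using BDp_bounded assms by metis
  \<comment> \<open>A bound at any single vertex, here \<open>undefined\<close>, forces the constant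
    to be nonnegative.\<close>
  have MN: "0 \<le> M" "0 \<le> N" using M[of undefined] N[of undefined] by linarith+
  show ?thesis
  proof (rule BDp_add_le[OF assms(1,2), of N M _ "M * N"])
    fix x y
    have "\<bar>f y * g y - f x * g x\<bar> = \<bar>(f y - f x) * g y + f x * (g y - g x)\<bar>"
      by (simp add: algebra_simps)
    also have "\<dots> \<le> \<bar>f y - f x\<bar> * \<bar>g y\<bar> + \<bar>f x\<bar> * \<bar>g y - g x\<bar>"
      by (metis abs_mult abs_triangle_ineq)
    also have "\<dots> \<le> \<bar>f y - f x\<bar> * N + M * \<bar>g y - g x\<bar>"
      using M N by (intro add_mono mult_mono) (auto simp: MN)
    finally show "\<bar>f y * g y - f x * g x\<bar> \<le> N * \<bar>f y - f x\<bar> + M * \<bar>g y - g x\<bar>"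
      by (simp add: mult.commute)
    show "\<bar>f x * g x\<bar> \<le> M * N"
      unfolding abs_mult using M N MN by (intro mult_mono) auto
  qed (use MN in auto)
qed

lemma BDp_cmult: "f \<in> \<B> \<Longrightarrow> (\<lambda>x. c * f x) \<in> \<B>"
  by (rule BDp_mult[OF BDp_const])

lemma BDp_diff: "f \<in> \<B> \<Longrightarrow> g \<in> \<B> \<Longrightarrow> (\<lambda>x. f x - g x) \<in> \<B>"
  using BDp_add[OF _ BDp_cmult[of g "- 1"]] by simp

lemma BDp_sum: "finite J \<Longrightarrow> (\<And>j. j \<in> J \<Longrightarrow> f j \<in> \<B>) \<Longrightarrow> (\<lambda>x. \<Sum>j\<in>J. f j x) \<in> \<B>"
proof (induction J rule: finite_induct)
  case empty
  show ?case using BDp_const[of 0] by simp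
next
  case (insert j J)
  then show ?case
    using BDp_add[of "f j" "\<lambda>x. \<Sum>j\<in>J. f j x"] by simp
qed

text \<open>Truncation at \<open>\<delta>\<close> keeps the argument in the range where the
  reciprocal has Lipschitz constant \<open>1 / \<delta>\<^sup>2\<close>.\<close>

lemma BDp_inverse_max:
  assumes "q \<in> \<B>" "0 < \<delta>"
  shows "(\<lambda>x. 1 / max (q x) \<delta>) \<in> \<B>"
proof (rule BDp_add_le[OF assms(1,1), of "1 / \<delta>\<^sup>2" 0 _ "1 / \<delta>"])
  fix x y
  define u v where "u = max (q x) \<delta>" and "v = max (q y) \<delta>"
  have uv: "\<delta> \<le> u" "\<delta> \<le> v" "\<bar>u - v\<bar> \<le> \<bar>q y - q x\<bar>"
    by (auto simp: u_def v_def)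
  have pos: "0 < u" "0 < v" using uv assms(2) by linarith+
  have "1 / v - 1 / u = (u - v) / (u * v)"
    using pos by (simp add: field_simps)
  then have "\<bar>1 / v - 1 / u\<bar> = \<bar>u - v\<bar> / (u * v)"
    using pos by (simp add: abs_mult)
  also have "\<dots> \<le> \<bar>q y - q x\<bar> / (\<delta> * \<delta>)"
    using uv assms(2) pos by (intro frac_le mult_mono) auto
  finally show "\<bar>1 / v - 1 / u\<bar> \<le> 1 / \<delta>\<^sup>2 * \<bar>q y - q x\<bar> + 0 * \<bar>q y - q x\<bar>"
    by (simp add: power2_eq_square)
  show "\<bar>1 / u\<bar> \<le> 1 / \<delta>"
    using uv pos assms(2) by (simp add: frac_le)
qed simp_all

lemma Cc_subset_Dp: "Cc \<subseteq> Dp adj p"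
proof
  fix g :: "'v \<Rightarrow> real" assume "g \<in> Cc"
  then have fin: "finite {x. g x \<noteq> 0}" by (simp add: Cc_def)
  \<comment> \<open>Energy can live only on the support and its neighbours; this set is finite
    because all degrees are.\<close>
  let ?F = "{x. g x \<noteq> 0} \<union> (\<Union>x\<in>{x. g x \<noteq> 0}. nbrs adj x)"
  have 0: "local_energy adj p g x = 0" if "x \<notin> ?F" for x
  proof -
    have "g y = 0" if "y \<in> nbrs adj x" for y
      using that \<open>x \<notin> ?F\<close> by (auto simp: nbrs_def adj_commute)
    then show ?thesis using that by (simp add: local_energy_def)
  qed
  have "finite ?F" using fin finite_nbrs by auto
  then have "local_energy adj p g summable_on ?F" by simp
  then show "g \<in> Dp adj p"
    unfolding Dp_def mem_Collect_eq
    using summable_on_cong_neutral[of UNIV ?F "local_energy adj p g" "local_energy adj p g"] 0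
    by blast
qed

lemma Cc_subset_BDp: "Cc \<subseteq> \<B>"
proof
  fix g :: "'v \<Rightarrow> real" assume g: "g \<in> Cc"
  then have "range g \<subseteq> insert 0 (g ` {x. g x \<noteq> 0})" by auto
  then have "finite (range g)"
    using g by (auto simp: Cc_def intro: finite_subset)
  then show "g \<in> \<B>"
    using Cc_subset_Dp g by (auto simp: BDp_def intro: finite_imp_bounded)
qed

lemma indicator_BDp: "finite F \<Longrightarrow> (indicator F :: 'v \<Rightarrow> real) \<in> \<B>"
  using Cc_subset_BDp by (auto simp: Cc_def indicator_def)

lemma BCc_closure_subset_BDp: "BCc_closure adj p b \<subseteq> \<B>"
  by (auto simp: BCc_closure_def Cc_closure_def BDp_def)

lemma Dp_diff:
  assumes "f \<in> Dp adj p" "g \<in> Dp adj p"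
  shows "(\<lambda>x. f x - g x) \<in> Dp adj p"
proof (rule Dp_add_le[OF assms, of 1 1])
  show "\<bar>f y - g y - (f x - g x)\<bar> \<le> 1 * \<bar>f y - f x\<bar> + 1 * \<bar>g y - g x\<bar>" for x y
    using abs_triangle_ineq4[of "f y - f x" "g y - g x"] by (simp add: algebra_simps)
qed (use p_gt_1 in auto)

section \<open>Characters and extreme points\<close>

lemma
  assumes "\<phi> \<in> Sp adj p" "f \<in> \<B>"
  shows Sp_add: "g \<in> \<B> \<Longrightarrow> \<phi> (\<lambda>x. f x + g x) = \<phi> f + \<phi> g"
    and Sp_mult: "g \<in> \<B> \<Longrightarrow> \<phi> (\<lambda>x. f x * g x) = \<phi> f * \<phi> g"
    and Sp_cmult: "\<phi> (\<lambda>x. c * f x) = of_real c * \<phi> f"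
  using assms unfolding Sp_def by blast+

lemma Sp_const:
  assumes "\<phi> \<in> Sp adj p"
  shows "\<phi> (\<lambda>_. c) = of_real c"
proof -
  obtain f where f: "f \<in> \<B>" "\<phi> f \<noteq> 0" using assms by (auto simp: Sp_def)
  have "\<phi> f = \<phi> f * \<phi> (\<lambda>_. 1)"
    using Sp_mult[OF assms f(1) BDp_const[of 1]] by simp
  then have "\<phi> (\<lambda>_. 1) = 1" using f(2) by simp
  then show ?thesis
    using Sp_cmult[OF assms BDp_const[of 1], of c] by simp
qed

lemma Sp_diff:
  assumes "\<phi> \<in> Sp adj p" "f \<in> \<B>" "g \<in> \<B>"
  shows "\<phi> (\<lambda>x. f x - g x) = \<phi> f - \<phi> g"
  using Sp_add[OF assms(1,2) BDp_cmult[OF assms(3), of "- 1"]] Sp_cmult[OF assms(1,3), of "- 1"]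
  by simp

lemma Sp_sum:
  assumes "\<phi> \<in> Sp adj p" "finite J" "\<And>j. j \<in> J \<Longrightarrow> f j \<in> \<B>"
  shows "\<phi> (\<lambda>x. \<Sum>j\<in>J. f j x) = (\<Sum>j\<in>J. \<phi> (f j))"
  using assms(2,3)
proof (induction J rule: finite_induct)
  case empty
  show ?case using Sp_const[OF assms(1), of 0] by simp
next
  case (insert j J)
  have "\<phi> (\<lambda>x. f j x + (\<Sum>j\<in>J. f j x)) = \<phi> (f j) + \<phi> (\<lambda>x. \<Sum>j\<in>J. f j x)"
    using insert by (intro Sp_add[OF assms(1)] BDp_sum) auto
  then show ?case using insert by simp
qed

lemma eval_char_apply: "f \<in> \<B> \<Longrightarrow> \<iota> x f = of_real (f x)"
  by (simp add: eval_char_def)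

lemma eval_char_in_Sp: "\<iota> x \<in> Sp adj p"
proof -
  have "\<exists>f\<in>\<B>. \<iota> x f \<noteq> 0"
    using BDp_const[of 1] by (intro bexI[of _ "\<lambda>_. 1"]) (simp_all add: eval_char_apply)
  moreover have "\<iota> x \<in> extensional \<B>"
    by (simp add: eval_char_def)
  ultimately show ?thesis
    unfolding Sp_def by (simp add: eval_char_apply BDp_add BDp_cmult BDp_mult)
qed

lemma topspace_X: "topspace X = Sp adj p"
  by (auto simp: Sp_top_def Sp_def PiE_def)

lemma continuous_map_eval: "f \<in> \<B> \<Longrightarrow> continuous_map X euclidean (\<lambda>\<phi>. \<phi> f)"
  unfolding Sp_top_def
  by (intro continuous_map_from_subtopology continuous_map_product_projection)

lemma Hausdorff_X: "Hausdorff_space X"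
  unfolding Sp_top_def
  by (intro Hausdorff_space_subtopology) (simp add: Hausdorff_space_product_topology)

text \<open>Having a value at \<open>f\<close> in a closed disc is a closed condition on characters,
  so it passes from the vertices in \<open>A\<close> to the closure.\<close>

lemma closure_eval_le:
  assumes "\<phi> \<in> X closure_of (\<iota> ` A)" "f \<in> \<B>" "\<And>x. x \<in> A \<Longrightarrow> cmod (of_real (f x) - c) \<le> \<eta>"
  shows "cmod (\<phi> f - c) \<le> \<eta>"
proof -
  have "closedin X {\<phi> \<in> topspace X. \<phi> f \<in> cball c \<eta>}"
    by (rule closedin_continuous_map_preimage[OF continuous_map_eval[OF assms(2)]]) simp
  moreover have "\<iota> ` A \<subseteq> {\<phi> \<in> topspace X. \<phi> f \<in> cball c \<eta>}"
    using assms(2,3) eval_char_in_Sp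
    by (auto simp: topspace_X eval_char_apply dist_norm norm_minus_commute)
  ultimately have "\<phi> \<in> {\<phi> \<in> topspace X. \<phi> f \<in> cball c \<eta>}"
    using assms(1) closure_of_minimal by blast
  then show ?thesis by (simp add: dist_norm norm_minus_commute)
qed

section \<open>Vertices among the characters, and the Royden boundary\<close>

text \<open>The product of \<open>f\<close> with the indicator of \<open>x\<close> is
  \<open>f x\<close> times that indicator. Applying \<open>\<phi>\<close> and cancelling its nonzero
  value on the indicator leaves \<open>\<phi> f = f x\<close>.\<close>

lemma Sp_eq_eval_char:
  assumes "\<phi> \<in> Sp adj p" "\<phi> (indicator {x}) \<noteq> 0"
  shows "\<phi> = \<iota> x"
proof (rule extensionalityI)
  show "\<phi> \<in> extensional \<B>" using assms by (simp add: Sp_def)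
  show "\<iota> x \<in> extensional \<B>" by (simp add: eval_char_def)
  fix f assume f: "f \<in> \<B>"
  let ?I = "indicator {x} :: 'v \<Rightarrow> real"
  have eq: "(\<lambda>y. f y * ?I y) = (\<lambda>y. f x * ?I y)"
    by (auto simp: indicator_def)
  have "\<phi> f * \<phi> ?I = \<phi> (\<lambda>y. f y * ?I y)"
    by (rule Sp_mult[OF assms(1) f, symmetric]) (simp add: indicator_BDp)
  also have "\<dots> = of_real (f x) * \<phi> ?I"
    unfolding eq by (rule Sp_cmult[OF assms(1)]) (simp add: indicator_BDp)
  finally have "\<phi> f * \<phi> ?I = of_real (f x) * \<phi> ?I" .
  then show "\<phi> f = \<iota> x f" using assms(2) by (simp add: eval_char_apply[OF f])
qed

lemma eval_char_indicator: "\<iota> x (indicator {y}) = (if x = y then 1 else 0)"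
  by (simp add: eval_char_apply indicator_BDp)

lemma inj_eval_char: "inj \<iota>"
  by (rule injI) (metis eval_char_indicator zero_neq_one)

text \<open>This describes the boundary by the vanishing of evaluations, which is what makes it
  closed.\<close>

lemma Royden_boundary_iff:
  "\<phi> \<in> Royden_boundary adj p \<longleftrightarrow> \<phi> \<in> Sp adj p \<and> (\<forall>x. \<phi> (indicator {x}) = 0)"
proof
  assume "\<phi> \<in> Royden_boundary adj p"
  then show "\<phi> \<in> Sp adj p \<and> (\<forall>x. \<phi> (indicator {x}) = 0)"
    using Sp_eq_eval_char unfolding Royden_boundary_def by blast
next
  assume *: "\<phi> \<in> Sp adj p \<and> (\<forall>x. \<phi> (indicator {x}) = 0)"
  then have "\<phi> \<noteq> \<iota> x" for x
    using eval_char_indicator[of x x] by auto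
  with * show "\<phi> \<in> Royden_boundary adj p"
    unfolding Royden_boundary_def by blast
qed

lemma closedin_zero_set: "f \<in> \<B> \<Longrightarrow> closedin X {\<phi> \<in> topspace X. \<phi> f \<in> {0}}"
  by (rule closedin_continuous_map_preimage[OF continuous_map_eval]) simp_all

lemma closedin_Royden_boundary: "closedin X (Royden_boundary adj p)"
proof -
  have "Royden_boundary adj p = (\<Inter>x. {\<phi> \<in> topspace X. \<phi> (indicator {x}) \<in> {0}})"
    by (auto simp: Royden_boundary_iff topspace_X)
  moreover have "closedin X (\<Inter>x. {\<phi> \<in> topspace X. \<phi> (indicator {x}) \<in> {0}})"
    by (rule closedin_INT) (auto intro: closedin_zero_set[simplified] indicator_BDp)
  ultimately show ?thesis by simp
qed

lemma extreme_pts_eval_eq_0: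
  assumes "\<phi> \<in> extreme_pts adj p \<gamma>" "f \<in> \<B>" "(\<lambda>n. f (\<gamma> n)) \<longlonglongrightarrow> 0"
  shows "\<phi> f = 0"
proof -
  have \<phi>: "\<phi> \<in> X closure_of (\<iota> ` range \<gamma>)" "\<phi> \<notin> range \<iota>"
    using assms(1) by (auto simp: extreme_pts_def Royden_boundary_def)
  have "cmod (\<phi> f) \<le> \<eta>" if \<eta>: "0 < \<eta>" for \<eta>
  proof -
    obtain N where N: "\<And>n. n \<ge> N \<Longrightarrow> norm (f (\<gamma> n)) < \<eta>"
      using LIMSEQ_D[OF assms(3) \<eta>] by auto
    \<comment> \<open>The first \<open>N\<close> vertices give a finite set of characters, closed
      since the space is Hausdorff. As \<open>\<phi>\<close> is not a vertex, it must lie in the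
      closure of the remaining tail.\<close>
    have "range \<gamma> = \<gamma> ` ({..<N} \<union> {N..})"
      by (rule arg_cong[where f = "image \<gamma>"]) auto
    then have "X closure_of (\<iota> ` range \<gamma>)
        = X closure_of (\<iota> ` \<gamma> ` {..<N}) \<union> X closure_of (\<iota> ` \<gamma> ` {N..})"
      by (simp only: image_Un closure_of_Un)
    moreover have "X closure_of (\<iota> ` \<gamma> ` {..<N}) = \<iota> ` \<gamma> ` {..<N}"
      by (intro closure_of_closedin closedin_Hausdorff_finite[OF Hausdorff_X])
        (auto simp: topspace_X eval_char_in_Sp)
    ultimately have "\<phi> \<in> X closure_of (\<iota> ` \<gamma> ` {N..})"
      using \<phi> by auto
    then have "cmod (\<phi> f - 0) \<le> \<eta>"
      by (rule closure_eval_le[OF _ assms(2)]) (use N in \<open>auto intro: less_imp_le\<close>)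
    then show ?thesis by simp
  qed
  then have "cmod (\<phi> f) \<le> 0" by (rule field_le_epsilon) simp
  then show ?thesis by simp
qed

section \<open>Compactness and the existence of extreme points\<close>

text \<open>Each algebraic identity for characters is the vanishing of a continuous function on the
  product that is zero at all vertices, so it survives in the closure. The limit is not the zero map
  because the value \<open>1\<close> at the constant function \<open>1\<close> survives as
  well.\<close>

lemma closure_of_vertices_in_Sp:
  assumes "\<phi> \<in> (product_topology (\<lambda>_. euclidean) \<B>) closure_of (range \<iota>)"
  shows "\<phi> \<in> Sp adj p"
proof -
  let ?T = "product_topology (\<lambda>_. euclidean :: complex topology) \<B>"
  have proj: "continuous_map ?T euclidean (\<lambda>\<psi>. \<psi> f)" if "f \<in> \<B>" for f
    using that by (rule continuous_map_product_projection)
  have closed: "\<phi> \<in> {\<psi> \<in> topspace ?T. h \<psi> \<in> {0}}"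
    if "continuous_map ?T euclidean h" "\<And>x. h (\<iota> x) = (0::complex)" for h
  proof -
    have "range \<iota> \<subseteq> {\<psi> \<in> topspace ?T. h \<psi> \<in> {0}}"
      using that(2) eval_char_in_Sp by (auto simp: Sp_def PiE_def)
    moreover have "closedin ?T {\<psi> \<in> topspace ?T. h \<psi> \<in> {0}}"
      by (rule closedin_continuous_map_preimage[OF that(1)]) simp
    ultimately show ?thesis using assms closure_of_minimal by blast
  qed
  \<comment> \<open>For the zero function, \<open>closed\<close> says only that
    \<open>\<phi>\<close> is in the carrier of the product, which already contains
    extensionality.\<close>
  have ext: "\<phi> \<in> extensional \<B>"
    using closed[of "\<lambda>_. 0"] by (auto simp: PiE_def)
  have add: "\<phi> (\<lambda>x. f x + g x) = \<phi> f + \<phi> g" if "f \<in> \<B>" "g \<in> \<B>" for f g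
    using closed[of "\<lambda>\<psi>. \<psi> (\<lambda>x. f x + g x) - (\<psi> f + \<psi> g)"] that
    by (simp add: proj continuous_map_diff continuous_map_add BDp_add eval_char_apply)
  have mult: "\<phi> (\<lambda>x. f x * g x) = \<phi> f * \<phi> g" if "f \<in> \<B>" "g \<in> \<B>" for f g
    using closed[of "\<lambda>\<psi>. \<psi> (\<lambda>x. f x * g x) - (\<psi> f * \<psi> g)"] that
    by (simp add: proj continuous_map_diff continuous_map_complex_mult BDp_mult eval_char_apply)
  have cmult: "\<phi> (\<lambda>x. c * f x) = of_real c * \<phi> f" if "f \<in> \<B>" for f c
    using closed[of "\<lambda>\<psi>. \<psi> (\<lambda>x. c * f x) - of_real c * \<psi> f"] that
    by (simp add: proj continuous_map_diff continuous_map_complex_mult BDp_cmult eval_char_apply)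
  have "\<phi> (\<lambda>_. 1) = 1"
    using closed[of "\<lambda>\<psi>. \<psi> (\<lambda>_. 1) - 1"]
    by (simp add: proj continuous_map_diff BDp_const eval_char_apply)
  then have "\<exists>f\<in>\<B>. \<phi> f \<noteq> 0" using BDp_const[of 1] by force
  then show ?thesis using ext add mult cmult by (simp add: Sp_def)
qed

text \<open>
  The characters \<open>\<iota> x\<close> all lie in a product of discs, which is compact by Tychonoff's theorem.
\<close>

lemma extreme_pts_nonempty:
  assumes "inj \<gamma>"
  shows "extreme_pts adj p \<gamma> \<noteq> {}"
proof -
  let ?T = "product_topology (\<lambda>_. euclidean :: complex topology) \<B>"
  obtain M where M: "\<And>f x. f \<in> \<B> \<Longrightarrow> \<bar>f x\<bar> \<le> M f"
    using BDp_bounded by metis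
  let ?K = "PiE \<B> (\<lambda>f. cball (0::complex) (M f))"
  have "compactin ?T ?K"
    unfolding compactin_PiE by (simp add: compactin_euclidean_iff)
  moreover have "infinite (\<iota> ` range \<gamma>)"
    using assms inj_eval_char
    by (metis finite_imageD infinite_UNIV_nat inj_on_subset subset_UNIV)
  moreover have "\<iota> ` range \<gamma> \<subseteq> ?K"
    using M by (auto simp: eval_char_def)
  ultimately obtain \<phi> where \<phi>: "\<phi> \<in> ?T derived_set_of (\<iota> ` range \<gamma>)"
    using compactin_imp_Bolzano_Weierstrass by blast
  have cl: "\<phi> \<in> ?T closure_of (\<iota> ` range \<gamma>)"
    using \<phi> by (simp add: closure_of derived_set_of_def)
  then have Sp: "\<phi> \<in> Sp adj p"
    by (intro closure_of_vertices_in_Sp) (use closure_of_mono[of "\<iota> ` range \<gamma>" "range \<iota>"] in blast)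
  \<comment> \<open>The open set where evaluation at the indicator of \<open>x\<close> is nonzero
    contains no vertex character except \<open>\<iota> x\<close>, so \<open>\<iota> x\<close> cannot
    be an accumulation point of vertices.\<close>
  have "\<phi> \<noteq> \<iota> x" for x
  proof
    assume eq: "\<phi> = \<iota> x"
    have "continuous_map ?T euclidean (\<lambda>\<psi>. \<psi> (indicator {x}))"
      by (rule continuous_map_product_projection) (simp add: indicator_BDp)
    then have "openin ?T {\<psi> \<in> topspace ?T. \<psi> (indicator {x}) \<in> - {0}}" (is "openin ?T ?U")
      by (rule openin_continuous_map_preimage) (simp add: open_Compl)
    moreover have "\<phi> \<in> topspace ?T"
      using \<phi> unfolding in_derived_set_of by (rule conjunct1)
    then have "\<phi> \<in> ?U"
      using eq eval_char_indicator[of x x] by simp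
    ultimately have "\<exists>\<psi>. \<psi> \<noteq> \<phi> \<and> \<psi> \<in> \<iota> ` range \<gamma> \<and> \<psi> \<in> ?U"
      using \<phi> unfolding in_derived_set_of by (metis (lifting))
    then obtain y where "\<iota> y \<noteq> \<phi>" "\<iota> y (indicator {x}) \<noteq> 0" by auto
    then show False using eq eval_char_indicator by (auto split: if_splits)
  qed
  then have "\<phi> \<in> Royden_boundary adj p" using Sp by (auto simp: Royden_boundary_def)
  moreover have "\<iota> ` range \<gamma> \<subseteq> Sp adj p" using eval_char_in_Sp by auto
  then have "\<phi> \<in> X closure_of (\<iota> ` range \<gamma>)"
    using cl Sp unfolding Sp_top_def closure_of_subtopology by (simp add: Int_absorb1)
  ultimately show ?thesis by (auto simp: extreme_pts_def)
qed

section \<open>The intersection lies in the harmonic boundary\<close>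

lemma E_set_Inter_subset:
  "(\<Inter>f\<in>BCc_closure adj p b. E_set adj p f) \<subseteq> harmonic_boundary adj p b"
proof
  fix \<phi> assume \<phi>: "\<phi> \<in> (\<Inter>f\<in>BCc_closure adj p b. E_set adj p f)"
  have sub: "\<phi> \<in> Royden_boundary adj p \<inter> {\<phi> \<in> topspace X. \<phi> f \<in> {0}}"
    if f: "f \<in> BCc_closure adj p b" for f
  proof -
    have fB: "f \<in> \<B>" using f BCc_closure_subset_BDp by blast
    have "(\<Union>\<gamma>\<in>inf_paths adj - exc_paths adj f. extreme_pts adj p \<gamma>)
        \<subseteq> Royden_boundary adj p \<inter> {\<phi> \<in> topspace X. \<phi> f \<in> {0}}"
      using extreme_pts_eval_eq_0[OF _ fB]
      by (auto simp: exc_paths_def extreme_pts_def topspace_X Royden_boundary_def)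
    then have "E_set adj p f \<subseteq> Royden_boundary adj p \<inter> {\<phi> \<in> topspace X. \<phi> f \<in> {0}}"
      unfolding E_set_def
      by (rule closure_of_minimal) (intro closedin_Int closedin_Royden_boundary closedin_zero_set fB)
    then show ?thesis using \<phi> f by blast
  qed
  \<comment> \<open>The index set of the intersection is nonempty; this instance puts
    \<open>\<phi>\<close> in the Royden boundary.\<close>
  moreover have "(\<lambda>_. 0) \<in> BCc_closure adj p b"
  proof -
    have "local_energy adj p (\<lambda>_. 0) = (\<lambda>_. 0)" by (auto simp: local_energy_def)
    then have "(\<lambda>_. 0) \<in> Cc_closure adj p b"
      unfolding Cc_closure_def
      by (intro CollectI conjI allI impI bexI[of _ "\<lambda>_. 0"])
        (simp_all add: Dp_const Dp_norm_def Ip_def Cc_def)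
    then show ?thesis by (simp add: BCc_closure_def)
  qed
  ultimately show "\<phi> \<in> harmonic_boundary adj p b"
    by (auto simp: harmonic_boundary_def)
qed

section \<open>Functions supported where all paths have infinite weighted length\<close>

text \<open>Under extension these walks form a tree. It branches finitely at the root because a
  one-vertex walk costs its index and \<open>idx\<close> is injective, and elsewhere because degrees
  are finite. If it were infinite, an infinite branch would be a path in \<open>S\<close> of bounded
  weighted length.\<close>

lemma finite_short_simple_walks:
  fixes idx :: "'v \<Rightarrow> nat"
  assumes W: "\<And>x. 0 \<le> W x" and idx: "inj idx"
    and paths: "\<And>\<gamma> R. \<gamma> \<in> inf_paths adj \<Longrightarrow> range \<gamma> \<subseteq> S \<Longrightarrow>
      \<exists>n. R < (\<Sum>i<n. min (W (\<gamma> i)) (W (\<gamma> (Suc i))))"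
  shows "finite {xs. walk_in adj S xs \<and> distinct xs \<and> walk_length idx W xs \<le> R}" (is "finite ?T")
proof (rule ccontr)
  assume "infinite ?T"
  moreover have "xs \<in> ?T" if "y # xs \<in> ?T" for y xs
    using that walk_in_tl[of adj S y xs] walk_length_tl[of W idx xs y, OF W] by auto
  moreover have "finite {y. y # xs \<in> ?T}" for xs
  proof (cases xs)
    case Nil
    have "{y. y # xs \<in> ?T} \<subseteq> idx -` {..nat \<lfloor>R\<rfloor>}"
      using Nil by (auto simp: le_nat_floor)
    then show ?thesis
      using finite_vimageI[OF _ idx] finite_subset by blast
  next
    case (Cons x zs)
    then have "{y. y # xs \<in> ?T} \<subseteq> nbrs adj x" by (auto simp: nbrs_def)
    then show ?thesis using finite_nbrs finite_subset by blast
  qed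
  ultimately obtain \<gamma> where \<gamma>: "\<And>n. rev (map \<gamma> [0..<n]) \<in> ?T"
    using koenig_list[of ?T] by blast
  have S: "range \<gamma> \<subseteq> S" and adj: "\<And>i. adj (\<gamma> i) (\<gamma> (Suc i))"
  proof -
    have "walk_in adj S (rev (map \<gamma> [0..<Suc n]))" for n
      using \<gamma>[of "Suc n"] by blast
    then have "\<gamma> i \<in> S \<and> adj (\<gamma> i) (\<gamma> (Suc i))" for i
      unfolding walk_in_rev_path by (metis le_Suc_eq lessI order_refl)
    then show "range \<gamma> \<subseteq> S" "\<And>i. adj (\<gamma> i) (\<gamma> (Suc i))" by auto
  qed
  have "inj \<gamma>"
  proof (rule linorder_injI)
    fix i j :: nat assume "i < j"
    have "distinct (map \<gamma> [0..<Suc j])" using \<gamma>[of "Suc j"] by (simp del: upt_Suc)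
    then have "inj_on \<gamma> {0..<Suc j}" by (simp only: distinct_map set_upt)
    then show "\<gamma> i \<noteq> \<gamma> j" using \<open>i < j\<close> by (auto dest: inj_onD[of _ _ i j])
  qed
  then have "\<gamma> \<in> inf_paths adj" using adj by (simp add: inf_paths_def nbrs_def)
  from paths[OF this S, of R] obtain n where
    "R < (\<Sum>i<n. min (W (\<gamma> i)) (W (\<gamma> (Suc i))))" by blast
  moreover have "walk_length idx W (rev (map \<gamma> [0..<Suc n])) \<le> R"
    using \<gamma>[of "Suc n"] by blast
  ultimately show False unfolding walk_length_rev_path by simp
qed

text \<open>Here \<open>d x\<close> is the infimum of the lengths of walks in \<open>S\<close>
  ending at \<open>x\<close>, from any starting vertex at the price of its index. No connectedness
  of \<open>S\<close> is needed for \<open>d\<close> to be finite. A point with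
  \<open>d x < R\<close> is the end of a walk shorter than \<open>R\<close>, which loop erasure
  makes simple, so finiteness follows from the count of short simple walks.\<close>

lemma proper_lipschitz_function:
  assumes W: "\<And>x. 0 \<le> W x"
    and paths: "\<And>\<gamma> R. \<gamma> \<in> inf_paths adj \<Longrightarrow> range \<gamma> \<subseteq> S \<Longrightarrow>
      \<exists>n. R < (\<Sum>i<n. min (W (\<gamma> i)) (W (\<gamma> (Suc i))))"
  obtains d :: "'v \<Rightarrow> real" where "\<And>x. x \<in> S \<Longrightarrow> 0 \<le> d x"
    and "\<And>x y. x \<in> S \<Longrightarrow> y \<in> S \<Longrightarrow> adj x y \<Longrightarrow> d y \<le> min (W x) (W y) + d x"
    and "\<And>R. finite {x \<in> S. d x < R}"
proof -
  obtain idx :: "'v \<Rightarrow> nat" where idx: "inj idx"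
    using countable_V by (auto simp: countable_def)
  define L where "L x = walk_length idx W ` {xs. walk_in adj S xs \<and> xs \<noteq> [] \<and> hd xs = x}" for x
  define d where "d x = Inf (L x)" for x
  have ne: "L x \<noteq> {}" if "x \<in> S" for x
    using that by (auto simp: L_def intro!: exI[of _ "[x]"])
  have bdd: "bdd_below (L x)" for x
    by (rule bdd_belowI[of _ 0]) (auto simp: L_def walk_length_nonneg W)
  have "0 \<le> d x" if "x \<in> S" for x
    unfolding d_def by (rule cInf_greatest[OF ne[OF that]]) (auto simp: L_def walk_length_nonneg W)
  moreover have "d y \<le> min (W x) (W y) + d x" if "x \<in> S" "y \<in> S" "adj x y" for x y
  proof -
    have "d y - min (W x) (W y) \<le> l" if l: "l \<in> L x" for l
    proof -
      obtain xs where xs: "walk_in adj S xs" "xs \<noteq> []" "hd xs = x" "l = walk_length idx W xs"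
        using l by (auto simp: L_def)
      then obtain zs where zs: "xs = x # zs" by (cases xs) auto
      have "walk_length idx W (y # xs) \<in> L y"
        unfolding L_def using xs zs \<open>y \<in> S\<close> \<open>adj x y\<close> by (intro imageI) simp
      then have "d y \<le> walk_length idx W (y # xs)"
        unfolding d_def by (rule cInf_lower[OF _ bdd])
      then show ?thesis using xs zs by simp
    qed
    then have "d y - min (W x) (W y) \<le> d x"
      unfolding d_def[of x] by (rule cInf_greatest[OF ne[OF that(1)]])
    then show ?thesis by simp
  qed
  moreover have "finite {x \<in> S. d x < R}" for R
  proof -
    have "{x \<in> S. d x < R} \<subseteq>
      hd ` {xs. walk_in adj S xs \<and> distinct xs \<and> walk_length idx W xs \<le> R}"
    proof
      fix x assume "x \<in> {x \<in> S. d x < R}"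
      then have x: "x \<in> S" "Inf (L x) < R" by (auto simp: d_def)
      then obtain l where "l \<in> L x" "l < R" using cInf_lessD[OF ne] by blast
      then obtain xs where xs: "walk_in adj S xs" "xs \<noteq> []" "hd xs = x" "walk_length idx W xs < R"
        by (auto simp: L_def)
      obtain ys where "walk_in adj S ys" "hd ys = x" "distinct ys"
        "walk_length idx W ys \<le> walk_length idx W xs"
        using walk_imp_simple_walk[of W adj S xs idx, OF W xs(1,2)] xs(3) by auto
      then show "x \<in> hd ` {xs. walk_in adj S xs \<and> distinct xs \<and> walk_length idx W xs \<le> R}"
        using xs(4) by (intro image_eqI[of _ _ ys]) auto
    qed
    moreover have "finite {xs. walk_in adj S xs \<and> distinct xs \<and> walk_length idx W xs \<le> R}"
      by (rule finite_short_simple_walks[OF W idx paths])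
    ultimately show ?thesis by (rule finite_subset[OF _ finite_imageI])
  qed
  ultimately show ?thesis using that by blast
qed

section \<open>Cutoffs and weights\<close>

text \<open>The remainder \<open>u n\<close> left after cutting \<open>G\<close> off at distance
  \<open>Suc n\<close> tends to \<open>0\<close> pointwise, and its local energies are dominated by
  those of \<open>G\<close> and by \<open>W powr p\<close>. Dominated convergence makes its norm
  vanish, while \<open>G - u n\<close> is supported in a finite ball.\<close>

lemma cutoff_in_Cc_closure:
  assumes W: "\<And>x. 0 \<le> W x" "(\<lambda>x. W x powr p) summable_on UNIV"
    and d0: "\<And>x. x \<in> S \<Longrightarrow> 0 \<le> d x"
    and d_le: "\<And>x y. x \<in> S \<Longrightarrow> y \<in> S \<Longrightarrow> adj x y \<Longrightarrow> d y \<le> min (W x) (W y) + d x"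
    and fin: "\<And>R. finite {x \<in> S. d x < R}"
    and G: "G \<in> \<B>" "\<And>x. x \<notin> S \<Longrightarrow> G x = 0"
  shows "G \<in> Cc_closure adj p b"
proof -
  obtain M where M: "\<And>x. \<bar>G x\<bar> \<le> M" using BDp_bounded[OF G(1)] by blast
  have M0: "0 \<le> M" using M[of undefined] by linarith
  obtain K :: nat where K: "\<And>x. card (nbrs adj x) \<le> K"
    using bdd_degree by (auto simp: bounded_degree_def)
  define k where "k n x = min 1 (d x / real (Suc n))" for n x
  define u where "u n x = G x * k n x" for n x
  have k01: "0 \<le> k n x" "k n x \<le> 1" if "x \<in> S" for n x
    using d0[OF that] by (auto simp: k_def)
  have k_lip: "\<bar>k n y - k n x\<bar> \<le> W x" if "x \<in> S" "y \<in> S" "adj x y" for n x y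
  proof -
    have "\<bar>d y - d x\<bar> \<le> W x"
      using d_le[of x y] d_le[of y x] that adj_commute[of x y] by (auto simp: min_def split: if_splits)
    moreover have "\<bar>d y / real (Suc n) - d x / real (Suc n)\<bar> \<le> \<bar>d y - d x\<bar>"
      by (simp add: diff_divide_distrib[symmetric] divide_le_eq mult_le_cancel_left1)
    moreover have "\<bar>min 1 s - min 1 t\<bar> \<le> \<bar>s - t\<bar>" for s t :: real
      by (simp add: min_def)
    ultimately show ?thesis unfolding k_def by (meson order_trans)
  qed
  have u_lip: "\<bar>u n y - u n x\<bar> \<le> M * W x + \<bar>G y - G x\<bar>" if "adj x y" for n x y
  proof -
    have MW: "0 \<le> M * W x" using M0 W(1) by simp
    \<comment> \<open>Nothing is known about \<open>d\<close> outside \<open>S\<close>. On an edge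
      leaving \<open>S\<close>, the vanishing of \<open>G\<close> outside and the bound
      \<open>k n \<le> 1\<close> inside replace the Lipschitz estimate.\<close>
    consider "x \<in> S" "y \<in> S" | "x \<in> S" "y \<notin> S" | "x \<notin> S" "y \<in> S" | "x \<notin> S" "y \<notin> S" by blast
    then show ?thesis
    proof cases
      case 1
      have "u n y - u n x = G y * (k n y - k n x) + k n x * (G y - G x)"
        by (simp add: u_def algebra_simps)
      then have "\<bar>u n y - u n x\<bar> \<le> \<bar>G y\<bar> * \<bar>k n y - k n x\<bar> + \<bar>k n x\<bar> * \<bar>G y - G x\<bar>"
        by (metis abs_mult abs_triangle_ineq)
      also have "\<dots> \<le> M * W x + 1 * \<bar>G y - G x\<bar>"
        using M M0 k_lip[OF 1 that] k01[OF 1(1)] by (intro add_mono mult_mono) auto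
      finally show ?thesis by simp
    next
      case 2
      have "\<bar>G x\<bar> * \<bar>k n x\<bar> \<le> \<bar>G x\<bar> * 1"
        using k01[OF 2(1)] by (intro mult_left_mono) auto
      then show ?thesis using 2 G(2) MW by (simp add: u_def abs_mult)
    next
      case 3
      have "\<bar>G y\<bar> * \<bar>k n y\<bar> \<le> \<bar>G y\<bar> * 1"
        using k01[OF 3(2)] by (intro mult_left_mono) auto
      then show ?thesis using 3 G(2) MW by (simp add: u_def abs_mult)
    next
      case 4
      show ?thesis using 4 G(2) MW by (simp add: u_def)
    qed
  qed
  \<comment> \<open>The term with \<open>W x\<close> does not depend on the neighbour, so summing it
    over the neighbours costs the degree bound \<open>K\<close>.\<close>
  define D where "D x = 2 powr p * (real K * (M powr p * W x powr p) + local_energy adj p G x)" for x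
  have D: "D summable_on UNIV"
    unfolding D_def using W(2) G(1)
    by (intro summable_on_cmult_right summable_on_add) (auto simp: BDp_def Dp_def)
  have E_le: "local_energy adj p (u n) x \<le> D x" for n x
  proof -
    have "local_energy adj p (u n) x \<le>
      (\<Sum>y\<in>nbrs adj x. 2 powr p * (M powr p * W x powr p + \<bar>G y - G x\<bar> powr p))"
      unfolding local_energy_def
    proof (rule sum_mono)
      fix y assume "y \<in> nbrs adj x"
      then have "\<bar>u n y - u n x\<bar> powr p \<le> (M * W x + \<bar>G y - G x\<bar>) powr p"
        using u_lip p_gt_1 by (intro powr_mono2) (auto simp: nbrs_def)
      also have "\<dots> \<le> 2 powr p * ((M * W x) powr p + \<bar>G y - G x\<bar> powr p)"
        using M0 W(1) p_gt_1 by (intro add_powr_le) auto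
      finally show "\<bar>u n y - u n x\<bar> powr p \<le> 2 powr p * (M powr p * W x powr p + \<bar>G y - G x\<bar> powr p)"
        using M0 W(1) by (simp add: powr_mult)
    qed
    also have "\<dots> = 2 powr p * (real (card (nbrs adj x)) * (M powr p * W x powr p) + local_energy adj p G x)"
      by (simp add: local_energy_def sum.distrib flip: sum_distrib_left)
    also have "\<dots> \<le> D x"
      unfolding D_def using K[of x] by (intro mult_left_mono add_right_mono mult_right_mono) auto
    finally show ?thesis .
  qed
  have u_lim: "(\<lambda>n. u n x) \<longlonglongrightarrow> 0" for x
  proof (cases "x \<in> S")
    case True
    have "(\<lambda>n. d x / real (Suc n)) \<longlonglongrightarrow> 0"
      by (rule LIMSEQ_Suc[OF lim_const_over_n])
    then have "(\<lambda>n. k n x) \<longlonglongrightarrow> min 1 0"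
      unfolding k_def by (intro tendsto_min tendsto_const)
    then have "(\<lambda>n. G x * k n x) \<longlonglongrightarrow> G x * min 1 0"
      by (intro tendsto_mult tendsto_const)
    then show ?thesis by (simp add: u_def)
  qed (simp add: u_def G(2))
  have powr_lim: "(\<lambda>n. v n powr a) \<longlonglongrightarrow> 0" if "v \<longlonglongrightarrow> 0" "\<And>n. 0 \<le> v n" "0 < a" for v :: "nat \<Rightarrow> real" and a
    using tendsto_powr'[OF that(1) tendsto_const[of a]] that by simp
  have "(\<lambda>n. local_energy adj p (u n) x) \<longlonglongrightarrow> (\<Sum>y\<in>nbrs adj x. 0)" for x
    unfolding local_energy_def
  proof (intro tendsto_sum powr_lim)
    fix y show "(\<lambda>n. \<bar>u n y - u n x\<bar>) \<longlonglongrightarrow> 0"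
      using tendsto_rabs[OF tendsto_diff[OF u_lim[of y] u_lim[of x]]] by simp
  qed (use p_gt_1 in auto)
  then have "(\<lambda>n. Ip adj p (u n)) \<longlonglongrightarrow> 0"
    unfolding Ip_def by (intro infsum_dominated_tendsto_0[OF D local_energy_nonneg E_le]) simp
  moreover have "(\<lambda>n. \<bar>u n b\<bar> powr p) \<longlonglongrightarrow> 0"
    using p_gt_1 tendsto_rabs[OF u_lim[of b]] by (intro powr_lim) auto
  ultimately have "(\<lambda>n. Ip adj p (u n) + \<bar>u n b\<bar> powr p) \<longlonglongrightarrow> 0"
    using tendsto_add by fastforce
  then have lim: "(\<lambda>n. Dp_norm adj p b (u n)) \<longlonglongrightarrow> 0"
    unfolding Dp_norm_def using p_gt_1
    by (intro powr_lim) (auto simp: Ip_def local_energy_nonneg infsum_nonneg)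
  define g where "g n x = G x - u n x" for n x
  have "g n \<in> Cc" for n
  proof -
    have "{x. g n x \<noteq> 0} \<subseteq> {x \<in> S. d x < real (Suc n)}"
    proof
      fix x assume "x \<in> {x. g n x \<noteq> 0}"
      then have "G x * (1 - k n x) \<noteq> 0" by (simp add: g_def u_def algebra_simps)
      then have "x \<in> S" "k n x \<noteq> 1" using G(2) by auto
      then show "x \<in> {x \<in> S. d x < real (Suc n)}"
        by (auto simp: k_def min_def divide_le_eq split: if_splits)
    qed
    then show ?thesis using fin finite_subset by (auto simp: Cc_def)
  qed
  moreover have "\<exists>n. Dp_norm adj p b (\<lambda>x. G x - g n x) < \<epsilon>" if \<epsilon>: "0 < \<epsilon>" for \<epsilon>
  proof -
    obtain n where "norm (Dp_norm adj p b (u n) - 0) < \<epsilon>"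
      using LIMSEQ_D[OF lim \<epsilon>] by blast
    moreover have "(\<lambda>x. G x - g n x) = u n" by (auto simp: g_def)
    ultimately show ?thesis by (intro exI[of _ n]) simp
  qed
  ultimately show ?thesis
    using G(1) unfolding Cc_closure_def BDp_def by blast
qed

text \<open>Choose \<open>g n\<close> in \<open>Cc\<close> so that the energy of
  \<open>e n = f - g n\<close> decays geometrically, and collect all these energies in one weight.
  Along a path of finite weighted length each \<open>e n\<close> varies by at most
  \<open>R * r n\<close>, and its initial value tends to \<open>0\<close> with \<open>n\<close>.
  Hence a single \<open>e n\<close> is small on the whole path, and \<open>f\<close> agrees with it
  once the path has left the support of \<open>g n\<close>.\<close>

lemma path_weight:
  assumes f: "f \<in> Cc_closure adj p b"
  obtains W :: "'v \<Rightarrow> real" where "\<And>x. 0 \<le> W x" "(\<lambda>x. W x powr p) summable_on UNIV"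
    and "\<And>\<gamma> R. \<gamma> \<in> inf_paths adj \<Longrightarrow> (\<And>n. (\<Sum>i<n. min (W (\<gamma> i)) (W (\<gamma> (Suc i)))) \<le> R) \<Longrightarrow>
      (\<lambda>n. f (\<gamma> n)) \<longlonglongrightarrow> 0"
proof -
  have p0: "0 < p" using p_gt_1 by simp
  \<comment> \<open>\<open>Dp_norm\<close> is a \<open>p\<close>-th root, so this accuracy puts the
    energy itself below \<open>(1/4) ^ n\<close>, leaving room for the later factor
    \<open>2 ^ n\<close>.\<close>
  have "\<forall>n. \<exists>g\<in>Cc. Dp_norm adj p b (\<lambda>x. f x - g x) < ((1/4) ^ n) powr (1 / p)"
    using f by (auto simp: Cc_closure_def)
  then obtain g where g: "\<And>n. g n \<in> Cc"
    "\<And>n. Dp_norm adj p b (\<lambda>x. f x - g n x) < ((1/4) ^ n) powr (1 / p)"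
    by metis
  define e where "e n x = f x - g n x" for n x
  define LE where "LE n = local_energy adj p (e n)" for n
  have LE0: "0 \<le> LE n x" for n x by (simp add: LE_def local_energy_nonneg)
  have LE_sum: "LE n summable_on UNIV" for n
    using Dp_diff[of f "g n"] f g(1) Cc_subset_Dp unfolding LE_def e_def
    by (auto simp: Cc_closure_def Dp_def)
  have Ip0: "0 \<le> Ip adj p (e n)" for n
    unfolding Ip_def by (intro infsum_nonneg local_energy_nonneg)
  have norm_lt: "Ip adj p (e n) + \<bar>e n b\<bar> powr p < (1/4) ^ n" for n
  proof (rule ccontr)
    assume "\<not> ?thesis"
    then have "((1/4) ^ n) powr (1 / p) \<le> (Ip adj p (e n) + \<bar>e n b\<bar> powr p) powr (1 / p)"
      using p0 by (intro powr_mono2) auto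
    then show False using g(2)[of n] by (simp add: Dp_norm_def e_def[abs_def])
  qed
  have LE_fin: "(\<Sum>x\<in>F. LE n x) \<le> (1/4) ^ n" if "finite F" for F n
  proof -
    have "(\<Sum>x\<in>F. LE n x) \<le> infsum (LE n) UNIV"
      by (rule finite_sum_le_infsum[OF LE_sum that]) (auto simp: LE0)
    also have "\<dots> = Ip adj p (e n)" by (simp add: Ip_def LE_def)
    also have "\<dots> \<le> (1/4) ^ n" using norm_lt[of n] powr_ge_zero[of "\<bar>e n b\<bar>" p] by linarith
    finally show ?thesis .
  qed
  have LE_fin2: "(\<Sum>x\<in>F. 2 ^ n * LE n x) \<le> (1/2) ^ n" if "finite F" for F n
  proof -
    have "(\<Sum>x\<in>F. 2 ^ n * LE n x) = 2 ^ n * (\<Sum>x\<in>F. LE n x)"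
      by (simp add: sum_distrib_left)
    also have "\<dots> \<le> 2 ^ n * (1/4) ^ n"
      using LE_fin[OF that] by (intro mult_left_mono) auto
    also have "\<dots> = (1/2) ^ n" by (simp flip: power_mult_distrib)
    finally show ?thesis .
  qed
  have geo: "summable (\<lambda>n. (1/2 :: real) ^ n)" by (rule summable_geometric) simp
  \<comment> \<open>The factor \<open>2 ^ n\<close> makes the edge differences of \<open>e n\<close> at most \<open>2 powr (- n / p)\<close> times the weight.\<close>
  define V where "V x = (\<Sum>n. 2 ^ n * LE n x)" for x
  have sV: "summable (\<lambda>n. 2 ^ n * LE n x)" for x
    by (rule summable_comparison_test'[OF geo, of 0]) (use LE_fin2[of "{x}"] LE0 in auto)
  have V_ge: "2 ^ n * LE n x \<le> V x" for n x
    unfolding V_def using sum_le_suminf[OF sV, of "{n}"] LE0 by simp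
  have V0: "0 \<le> V x" for x
    using V_ge[of 0 x] LE0[of 0 x] by simp
  have V_sum: "V summable_on UNIV"
  proof (rule nonneg_bdd_above_summable_on)
    show "bdd_above (sum V ` {F. F \<subseteq> UNIV \<and> finite F})"
    proof (rule bdd_aboveI[of _ "\<Sum>n. (1/2 :: real) ^ n"])
      fix s assume "s \<in> sum V ` {F. F \<subseteq> UNIV \<and> finite F}"
      then obtain F where F: "finite F" "s = sum V F" by auto
      have "s = (\<Sum>n. \<Sum>x\<in>F. 2 ^ n * LE n x)"
        unfolding F(2) V_def by (rule suminf_sum[symmetric]) (rule sV)
      also have "\<dots> \<le> (\<Sum>n. (1/2) ^ n)"
        by (intro suminf_le LE_fin2 F(1) geo summable_sum sV)
      finally show "s \<le> (\<Sum>n. (1/2) ^ n)" .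
    qed
  qed (rule V0)
  define W where "W x = V x powr (1 / p)" for x
  have W0: "0 \<le> W x" for x by (simp add: W_def)
  have W_powr: "W x powr p = V x" for x
    using p0 V0 by (simp add: W_def powr_powr)
  define r where "r n = ((1/2 :: real) ^ n) powr (1 / p)" for n
  have r0: "0 \<le> r n" for n by (simp add: r_def)
  have powr_lim: "(\<lambda>n. (c ^ n) powr (1 / p)) \<longlonglongrightarrow> 0" if "0 \<le> c" "c < 1" for c :: real
    using tendsto_powr'[OF LIMSEQ_realpow_zero[OF that] tendsto_const[of "1 / p"]] that p0 by simp
  have r_lim: "r \<longlonglongrightarrow> 0"
    using powr_lim[of "1/2"] unfolding r_def by simp
  have root: "\<bar>t\<bar> \<le> s powr (1 / p)" if "\<bar>t\<bar> powr p \<le> s" for t s :: real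
    using powr_mono2[OF _ _ that, of "1 / p"] p0 by (simp add: powr_powr)
  have edge: "\<bar>e n y - e n x\<bar> \<le> W x * r n" if "adj x y" for n x y
  proof -
    have "\<bar>e n y - e n x\<bar> powr p \<le> LE n x"
      unfolding LE_def local_energy_def
      by (rule member_le_sum[of y _ "\<lambda>y. \<bar>e n y - e n x\<bar> powr p"])
        (use that finite_nbrs in \<open>auto simp: nbrs_def\<close>)
    also have "\<dots> \<le> V x * (1/2) ^ n"
      using V_ge[of n x] by (simp add: field_simps)
    finally have "\<bar>e n y - e n x\<bar> \<le> (V x * (1/2) ^ n) powr (1 / p)" by (rule root)
    then show ?thesis using V0 by (simp add: W_def r_def powr_mult)
  qed
  \<comment> \<open>Both orientations of the edge give a bound. The minimum is symmetric and lies
    below the weight of either endpoint, which later makes the distance Lipschitz in both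
    directions.\<close>
  have edge': "\<bar>e n y - e n x\<bar> \<le> min (W x) (W y) * r n" if "adj x y" for n x y
    using edge[OF that, of n] edge[of y x n] that adj_commute[of x y]
    by (auto simp: min_def abs_minus_commute)
  \<comment> \<open>The norm controls the value at \<open>b\<close> only; convergence spreads from
    there along edges by connectedness.\<close>
  have e_lim: "(\<lambda>n. e n x) \<longlonglongrightarrow> 0" for x
  proof -
    have "adj\<^sup>*\<^sup>* b x" using connected by (simp add: connected_graph_def)
    then show ?thesis
    proof (induction rule: rtranclp_induct)
      case base
      have "\<bar>e n b\<bar> powr p \<le> (1/4) ^ n" for n
        using norm_lt[of n] Ip0[of n] by linarith
      then have "norm (e n b) \<le> ((1/4) ^ n) powr (1 / p)" for n
        unfolding real_norm_def by (rule root)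
      then show ?case
        by (intro Lim_null_comparison[OF always_eventually powr_lim[of "1/4"]]) simp_all
    next
      case (step x y)
      have "(\<lambda>n. W x * r n) \<longlonglongrightarrow> 0"
        using tendsto_mult[OF tendsto_const r_lim, of "W x"] by simp
      moreover have "\<forall>\<^sub>F n in sequentially. norm (e n y - e n x) \<le> W x * r n"
        using edge[OF step(2)] by simp
      ultimately have "(\<lambda>n. e n y - e n x) \<longlonglongrightarrow> 0"
        by (rule Lim_null_comparison[rotated])
      then have "(\<lambda>n. (e n y - e n x) + e n x) \<longlonglongrightarrow> 0 + 0"
        using step(3) by (rule tendsto_add)
      then show ?case by simp
    qed
  qed
  have "(\<lambda>n. f (\<gamma> n)) \<longlonglongrightarrow> 0"
    if \<gamma>: "\<gamma> \<in> inf_paths adj" and R: "\<And>n. (\<Sum>i<n. min (W (\<gamma> i)) (W (\<gamma> (Suc i)))) \<le> R" for \<gamma> R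
  proof (rule LIMSEQ_I)
    fix \<epsilon> :: real assume \<epsilon>: "0 < \<epsilon>"
    have \<gamma>_adj: "adj (\<gamma> i) (\<gamma> (Suc i))" and "inj \<gamma>" for i
      using \<gamma> by (auto simp: inf_paths_def nbrs_def)
    have tele: "\<bar>e n (\<gamma> m)\<bar> \<le> \<bar>e n (\<gamma> 0)\<bar> + (\<Sum>i<m. min (W (\<gamma> i)) (W (\<gamma> (Suc i)))) * r n" for n m
    proof (induction m)
      case (Suc m)
      then show ?case using edge'[OF \<gamma>_adj[of m], of n] by (simp add: algebra_simps)
    qed simp
    have "(\<lambda>n. \<bar>e n (\<gamma> 0)\<bar> + R * r n) \<longlonglongrightarrow> \<bar>0\<bar> + R * 0"
      by (intro tendsto_intros e_lim r_lim)
    then obtain n where n: "norm (\<bar>e n (\<gamma> 0)\<bar> + R * r n - 0) < \<epsilon>"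
      using LIMSEQ_D[OF _ \<epsilon>] by fastforce
    have small: "\<bar>e n (\<gamma> m)\<bar> < \<epsilon>" for m
    proof -
      have "(\<Sum>i<m. min (W (\<gamma> i)) (W (\<gamma> (Suc i)))) * r n \<le> R * r n"
        using R r0 by (intro mult_right_mono)
      then show ?thesis using tele[of n m] n by simp
    qed
    \<comment> \<open>An injective path meets the finite support of \<open>g n\<close> only finitely
      often.\<close>
    have "finite {m. g n (\<gamma> m) \<noteq> 0}"
      using finite_vimageI[of "{x. g n x \<noteq> 0}" \<gamma>] g(1)[of n] \<open>inj \<gamma>\<close>
      by (simp add: Cc_def vimage_def)
    then obtain N where N: "\<And>m. m \<ge> N \<Longrightarrow> g n (\<gamma> m) = 0"
      by (metis (mono_tags, lifting) finite_nat_set_iff_bounded leD mem_Collect_eq)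
    have "norm (f (\<gamma> m) - 0) < \<epsilon>" if "m \<ge> N" for m
      using small[of m] N[OF that] by (simp add: e_def)
    then show "\<exists>N. \<forall>m\<ge>N. norm (f (\<gamma> m) - 0) < \<epsilon>" by blast
  qed
  moreover have "(\<lambda>x. W x powr p) summable_on UNIV"
    using V_sum by (simp add: W_powr)
  ultimately show ?thesis
    using that[of W] W0 by blast
qed

text \<open>By \<open>path_weight\<close>, a path of finite weighted length would have
  \<open>f\<close> tending to \<open>0\<close>; hence all paths in \<open>S\<close> have infinite
  length, and the distance on \<open>S\<close> provides the cutoffs of \<open>G\<close>.\<close>

lemma BCc_closureI:
  assumes f: "f \<in> Cc_closure adj p b" and G: "G \<in> \<B>" "\<And>x. x \<notin> S \<Longrightarrow> G x = 0"
    and paths: "\<And>\<gamma>. \<gamma> \<in> inf_paths adj \<Longrightarrow> range \<gamma> \<subseteq> S \<Longrightarrow> \<not> (\<lambda>n. f (\<gamma> n)) \<longlonglongrightarrow> 0"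
  shows "G \<in> BCc_closure adj p b"
proof -
  obtain W where W: "\<And>x. 0 \<le> W x" "(\<lambda>x. W x powr p) summable_on UNIV"
    and lim: "\<And>\<gamma> R. \<gamma> \<in> inf_paths adj \<Longrightarrow> (\<And>n. (\<Sum>i<n. min (W (\<gamma> i)) (W (\<gamma> (Suc i)))) \<le> R) \<Longrightarrow>
      (\<lambda>n. f (\<gamma> n)) \<longlonglongrightarrow> 0"
    using path_weight[OF f] by blast
  have "\<exists>n. R < (\<Sum>i<n. min (W (\<gamma> i)) (W (\<gamma> (Suc i))))"
    if "\<gamma> \<in> inf_paths adj" "range \<gamma> \<subseteq> S" for \<gamma> R
  proof (rule ccontr)
    assume "\<not> ?thesis"
    then have "(\<Sum>i<n. min (W (\<gamma> i)) (W (\<gamma> (Suc i)))) \<le> R" for n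
      by (simp add: not_less)
    then show False using lim[OF that(1)] paths[OF that] by blast
  qed
  then obtain d where "\<And>x. x \<in> S \<Longrightarrow> 0 \<le> d x"
    "\<And>x y. x \<in> S \<Longrightarrow> y \<in> S \<Longrightarrow> adj x y \<Longrightarrow> d y \<le> min (W x) (W y) + d x"
    "\<And>R. finite {x \<in> S. d x < R}"
    using proper_lipschitz_function[of W S, OF W(1)] by blast
  then have "G \<in> Cc_closure adj p b"
    by (rule cutoff_in_Cc_closure[OF W _ _ _ G])
  then show ?thesis using G(1) by (simp add: BCc_closure_def BDp_def)
qed

section \<open>The harmonic boundary lies in every \<open>E_set\<close>\<close>

lemma harmonic_boundary_subset:
  assumes f: "f \<in> BCc_closure adj p b"
  shows "harmonic_boundary adj p b \<subseteq> E_set adj p f"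
proof
  fix \<psi> assume \<psi>: "\<psi> \<in> harmonic_boundary adj p b"
  then have Sp: "\<psi> \<in> Sp adj p" by (auto simp: harmonic_boundary_def Royden_boundary_def)
  show "\<psi> \<in> E_set adj p f"
  proof (rule ccontr)
    assume "\<psi> \<notin> E_set adj p f"
    have "openin X (topspace X - E_set adj p f)"
      unfolding E_set_def by (intro openin_diff openin_topspace closedin_closure_of)
    then obtain T where T: "openin (product_topology (\<lambda>_. euclidean) \<B>) T"
      "topspace X - E_set adj p f = T \<inter> Sp adj p"
      unfolding Sp_top_def openin_subtopology by blast
    have "\<psi> \<in> T" using T(2) Sp \<open>\<psi> \<notin> E_set adj p f\<close> by (auto simp: topspace_X)
    from bspec[OF T(1)[unfolded openin_product_topology_alt] this]
    obtain U where U: "finite {j \<in> \<B>. U j \<noteq> UNIV}"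
      "\<forall>j\<in>\<B>. open (U j)" "\<psi> \<in> Pi\<^sub>E \<B> U" "Pi\<^sub>E \<B> U \<subseteq> T"
      unfolding open_openin[symmetric] topspace_euclidean by (elim exE conjE)
    define J where "J = {j \<in> \<B>. U j \<noteq> UNIV}"
    have J: "finite J" "J \<subseteq> \<B>" using U(1) by (auto simp: J_def)
    have "\<exists>\<epsilon>>0. \<forall>z. cmod (z - \<psi> j) < \<epsilon> \<longrightarrow> z \<in> U j" if "j \<in> J" for j
    proof -
      have "open (U j)" "\<psi> j \<in> U j" using U(2,3) that J(2) by auto
      then show ?thesis unfolding open_dist dist_norm by blast
    qed
    then obtain \<epsilon>' where \<epsilon>': "\<And>j. j \<in> J \<Longrightarrow> 0 < \<epsilon>' j"
      "\<And>j z. j \<in> J \<Longrightarrow> cmod (z - \<psi> j) < \<epsilon>' j \<Longrightarrow> z \<in> U j"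
      by metis
    \<comment> \<open>The extra element \<open>1\<close> keeps the minimum defined when no
      coordinate is constrained.\<close>
    define \<epsilon> where "\<epsilon> = Min (insert 1 (\<epsilon>' ` J))"
    have \<epsilon>: "0 < \<epsilon>" using J(1) \<epsilon>'(1) by (auto simp: \<epsilon>_def)
    have \<epsilon>_U: "z \<in> U j" if "j \<in> J" "cmod (z - \<psi> j) < \<epsilon>" for j z
    proof -
      have "\<epsilon> \<le> \<epsilon>' j" unfolding \<epsilon>_def using J(1) that(1) by (intro Min_le) auto
      then show ?thesis using \<epsilon>'(2)[OF that(1), of z] that(2) by simp
    qed
    \<comment> \<open>Passing to the closure gives only a non-strict bound; halving
      \<open>\<epsilon>\<close> turns it into the strict bound that membership in \<open>U j\<close>
      requires.\<close>
    define \<delta> where "\<delta> = (\<epsilon> / 2)\<^sup>2"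
    have \<delta>: "0 < \<delta>" using \<epsilon> by (simp add: \<delta>_def)
    \<comment> \<open>The value \<open>\<psi> j\<close> may be complex while the functions in the
      algebra are real, so the squared modulus is written out through real and imaginary
      parts.\<close>
    define s where "s j x = (j x - Re (\<psi> j)) * (j x - Re (\<psi> j)) + Im (\<psi> j) * Im (\<psi> j)"
      for j :: "'v \<Rightarrow> real" and x
    have sB: "s j \<in> \<B>" if "j \<in> J" for j
      unfolding s_def using that J(2) by (intro BDp_add BDp_mult BDp_diff BDp_const) auto
    have s_eq: "s j x = (cmod (of_real (j x) - \<psi> j))\<^sup>2" for j x
      unfolding s_def cmod_power2 by (simp add: power2_eq_square)
    have \<psi>_s: "\<psi> (s j) = 0" if "j \<in> J" for j
    proof -
      have j: "j \<in> \<B>" using that J(2) by auto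
      have dB: "(\<lambda>x. j x - Re (\<psi> j)) \<in> \<B>" by (rule BDp_diff[OF j BDp_const])
      have "\<psi> (s j) = (\<psi> j - of_real (Re (\<psi> j))) * (\<psi> j - of_real (Re (\<psi> j)))
          + of_real (Im (\<psi> j) * Im (\<psi> j))"
        unfolding s_def Sp_add[OF Sp BDp_mult[OF dB dB] BDp_const] Sp_mult[OF Sp dB dB]
          Sp_diff[OF Sp j BDp_const] Sp_const[OF Sp] ..
      \<comment> \<open>The difference \<open>\<psi> j - Re (\<psi> j)\<close> is purely imaginary,
        so its square cancels the added square of the imaginary part.\<close>
      then show ?thesis by (simp add: complex_eq_iff)
    qed
    define q where "q x = (\<Sum>j\<in>J. s j x)" for x
    have qB: "q \<in> \<B>" unfolding q_def using J(1) sB by (rule BDp_sum)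
    have \<psi>_q: "\<psi> q = 0"
      unfolding q_def using Sp_sum[OF Sp J(1) sB] \<psi>_s by simp
    define r where "r x = 1 / max (q x) \<delta>" for x
    have rB: "r \<in> \<B>" unfolding r_def by (rule BDp_inverse_max[OF qB \<delta>])
    define G where "G x = 1 - q x * r x" for x
    have GB: "G \<in> \<B>" unfolding G_def by (intro BDp_diff BDp_mult BDp_const qB rB)
    have "\<psi> G = 1"
      unfolding G_def Sp_diff[OF Sp BDp_const BDp_mult[OF qB rB]] Sp_const[OF Sp] Sp_mult[OF Sp qB rB]
      by (simp add: \<psi>_q)
    have "G \<in> BCc_closure adj p b"
    proof (rule BCc_closureI[of f G "{x. q x < \<delta>}"])
      show "f \<in> Cc_closure adj p b" using f by (simp add: BCc_closure_def)
      show "G x = 0" if "x \<notin> {x. q x < \<delta>}" for x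
        using that \<delta> by (simp add: G_def r_def max_def)
      fix \<gamma> assume \<gamma>: "\<gamma> \<in> inf_paths adj" "range \<gamma> \<subseteq> {x. q x < \<delta>}"
      show "\<not> (\<lambda>n. f (\<gamma> n)) \<longlonglongrightarrow> 0"
      proof
        assume "(\<lambda>n. f (\<gamma> n)) \<longlonglongrightarrow> 0"
        then have \<gamma>_in: "\<gamma> \<in> inf_paths adj - exc_paths adj f" using \<gamma>(1) by (simp add: exc_paths_def)
        obtain \<phi> where \<phi>: "\<phi> \<in> extreme_pts adj p \<gamma>"
          using extreme_pts_nonempty[of \<gamma>] \<gamma>(1) by (auto simp: inf_paths_def)
        have \<phi>_cl: "\<phi> \<in> X closure_of (\<iota> ` range \<gamma>)" and \<phi>_Sp: "\<phi> \<in> Sp adj p"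
          using \<phi> by (auto simp: extreme_pts_def Royden_boundary_def)
        have "(\<Union>\<gamma>\<in>inf_paths adj - exc_paths adj f. extreme_pts adj p \<gamma>) \<subseteq> topspace X"
          by (auto simp: extreme_pts_def Royden_boundary_def topspace_X)
        then have "\<phi> \<in> E_set adj p f"
          unfolding E_set_def using \<phi> \<gamma>_in closure_of_subset by blast
        moreover have "\<phi> \<in> T"
        proof -
          have "\<phi> j \<in> U j" if "j \<in> \<B>" for j
          proof (cases "j \<in> J")
            case True
            have "cmod (\<phi> j - \<psi> j) \<le> \<epsilon> / 2"
            proof (rule closure_eval_le[OF \<phi>_cl that])
              fix x assume "x \<in> range \<gamma>"
              have "s j x \<le> q x"
                unfolding q_def using J(1) True by (intro member_le_sum) (auto simp: s_eq)
              also have "\<dots> \<le> \<delta>" using \<open>x \<in> range \<gamma>\<close> \<gamma>(2) by auto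
              finally show "cmod (of_real (j x) - \<psi> j) \<le> \<epsilon> / 2"
                unfolding s_eq \<delta>_def by (rule power2_le_imp_le) (use \<epsilon> in simp)
            qed
            then show ?thesis using \<epsilon> by (intro \<epsilon>_U[OF True]) simp
          qed (use that in \<open>auto simp: J_def\<close>)
          moreover have "\<phi> \<in> extensional \<B>" using \<phi>_Sp by (simp add: Sp_def)
          ultimately show ?thesis using U(4) by (auto simp: PiE_def)
        qed
        ultimately show False using T(2) \<phi>_Sp by blast
      qed
    qed (rule GB)
    then have "\<psi> G = 0" using \<psi> by (simp add: harmonic_boundary_def)
    then show False using \<open>\<psi> G = 1\<close> by simp
  qed
qed

end

theorem theorem3p2:
  fixes adj :: "'v \<Rightarrow> 'v \<Rightarrow> bool" and p :: real and b :: 'v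
  assumes "p > 1"
    and "symp adj" and "irreflp adj"
    and "connected_graph adj"
    and "bounded_degree adj"
    and "countable (UNIV :: 'v set)" and "infinite (UNIV :: 'v set)"
  shows "harmonic_boundary adj p b = (\<Inter>f\<in>BCc_closure adj p b. E_set adj p f)"
proof -
  interpret royden adj p b
    by unfold_locales (use assms in auto)
  show ?thesis
    using harmonic_boundary_subset E_set_Inter_subset by blast
qed

end
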